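(* For every integer $q \geq 2$, the competition number of the Hamming graph $H(2,q)$ is $k(H(2,q)) = 2$.
   Context: For a positive integer $q$, let $[q]=\{1,2,\ldots,q\}$, and let $[q]^n$ be the set of $n$-tuples over $[q]$. For positive integers $n,q$, the Hamming graph $H(n,q)$ has vertex set $[q]^n$, and two vertices $x=(x_1,\ldots,x_n)$, $y=(y_1,\ldots,y_n)$ are adjacent if and only if $|\{i\in[n] \mid x_i\neq y_i\}|=1$. All graphs and digraphs are finite. The competition graph $C(D)$ of a digraph $D$ is the simple undirected graph with the same vertex set as $D$ in which two distinct vertices $u$ and $v$ are adjacent if and only if there is a vertex $x$ of $D$ such that both $(u,x)$ and $(v,x)$ are arcs of $D$. The competition number $k(G)$ of a graph $G$ is the smallest integer $k\geq 0$ such that $G$ together with $k$ additional isolated vertices is the competition graph of an acyclic digraph (a digraph with no directed cycles). *)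

theory Defs
  imports "Graph_Theory.Pair_Digraph"
begin

text \<open>
  Digraphs have vertex set \<open>pverts\<close> and arc set \<open>parcs\<close> (no parallel arcs, loops allowed
  in general). As in the library, a simple undirected graph is represented by a symmetric
  loop-free digraph on a finite vertex set, i.e. by an instance of \<open>pair_graph\<close>.
\<close>

definition hamming_graph :: "nat \<Rightarrow> nat \<Rightarrow> nat list pair_pre_digraph" where
  "hamming_graph n q =
     \<lparr> pverts = {x. length x = n \<and> set x \<subseteq> {1..q}},
       parcs = {(x, y). length x = n \<and> set x \<subseteq> {1..q} \<and> length y = n \<and> set y \<subseteq> {1..q} \<and>
                        card {i. i < n \<and> x ! i \<noteq> y ! i} = 1} \<rparr>"

definition competition_graph :: "'a pair_pre_digraph \<Rightarrow> 'a pair_pre_digraph" where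
  "competition_graph D =
     \<lparr> pverts = pverts D,
       parcs = {(u, v). u \<in> pverts D \<and> v \<in> pverts D \<and> u \<noteq> v \<and>
                        (\<exists>x \<in> pverts D. (u, x) \<in> parcs D \<and> (v, x) \<in> parcs D)} \<rparr>"

text \<open>The library's cycles are nonempty and include loops and cycles of length two.\<close>

definition acyclic_digraph :: "'a pair_pre_digraph \<Rightarrow> bool" where
  "acyclic_digraph D \<longleftrightarrow> pair_fin_digraph D \<and> \<not> (\<exists>p. pre_digraph.cycle (with_proj D) p)"

definition add_isolated :: "'a pair_pre_digraph \<Rightarrow> nat \<Rightarrow> ('a + nat) pair_pre_digraph" where
  "add_isolated G k =
     \<lparr> pverts = pverts G <+> {..<k},
       parcs = map_prod Inl Inl ` parcs G \<rparr>"

text \<open>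
  For every finite simple graph some \<open>k\<close> has the property below (one extra vertex per edge
  suffices), so the minimum is attained.
\<close>

definition competition_number :: "'a pair_pre_digraph \<Rightarrow> nat" where
  "competition_number G =
     (LEAST k. \<exists>D. acyclic_digraph D \<and> competition_graph D = add_isolated G k)"

lemma finite_hamming_verts: "finite (pverts (hamming_graph n q))"
proof -
  have "pverts (hamming_graph n q) = {x. set x \<subseteq> {1..q} \<and> length x = n}"
    unfolding hamming_graph_def by auto
  then show ?thesis
    by (simp only: finite_lists_length_eq finite_atLeastAtMost)
qed

lemma pair_graph_hamming_graph: "pair_graph (hamming_graph n q)"
proof -
  let ?G = "hamming_graph n q"
  have arcs: "parcs ?G \<subseteq> pverts ?G \<times> pverts ?G"
    unfolding hamming_graph_def by auto
  have sym: "sym (parcs ?G)"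
  proof (rule symI)
    fix x y assume xy: "(x, y) \<in> parcs ?G"
    have "{i. i < n \<and> y ! i \<noteq> x ! i} = {i. i < n \<and> x ! i \<noteq> y ! i}"
      by (rule Collect_cong) metis
    with xy show "(y, x) \<in> parcs ?G"
      unfolding hamming_graph_def by simp
  qed
  have irrefl: "(x, x) \<notin> parcs ?G" for x
    by (simp add: hamming_graph_def)
  have loopfree: "fst e \<noteq> snd e" if "e \<in> parcs ?G" for e
    using that irrefl[of "fst e"] by (metis prod.collapse)
  have fin: "finite (parcs ?G)"
    using arcs finite_hamming_verts by (meson finite_SigmaI finite_subset)
  have wf: "pair_wf_digraph ?G"
    by (rule pair_wf_digraph.intro; use arcs in \<open>auto simp: subset_iff mem_Times_iff\<close>)
  have fd: "pair_fin_digraph ?G"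
    by (rule pair_fin_digraph.intro[OF wf pair_fin_digraph_axioms.intro[OF finite_hamming_verts fin]])
  have sd: "pair_sym_digraph ?G"
    by (rule pair_sym_digraph.intro[OF wf pair_sym_digraph_axioms.intro])
      (simp add: symmetric_def sym)
  have ld: "pair_loopfree_digraph ?G"
    by (rule pair_loopfree_digraph.intro[OF wf pair_loopfree_digraph_axioms.intro[OF loopfree]])
  show ?thesis
    by (rule pair_graph.intro[OF pair_digraph.intro[OF fd ld] pair_pseudo_graph.intro[OF fd sd]])
qed

end

theory Submission
  imports Defs
begin

text \<open>
  Lower bound: in an acyclic digraph some vertex \<open>v\<close> of \<open>H(2,q)\<close> has only isolated extra vertices
  as prey. A neighbour of \<open>v\<close> in its row and one in its column are not adjacent, so they must share
  different prey with \<open>v\<close>, which requires two extra vertices.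

  Upper bound: give each of the \<open>2q\<close> rows and columns its own prey, common to all its members.
  Order the vertices as: all \<open>[i, j]\<close> with \<open>i, j \<ge> 2\<close>, then \<open>[q, 1], \<dots>, [2, 1]\<close>, then
  \<open>[1, q], \<dots>, [1, 1]\<close>, then the two extra vertices. The prey of a line can be chosen after all its
  members, because each of the last \<open>2q - 1\<close> vertices of \<open>H(2,q)\<close> is the last member of just one
  line, except for \<open>[1, 1]\<close>, which is the last of two.
\<close>

text \<open>Every closed walk contains a cycle, and a nonempty walk from \<open>x\<close> back to
  \<open>x\<close> is a pair \<open>(x, x)\<close> in the transitive closure. In this form
  acyclicity follows from a \<open>measure\<close> and yields well-foundedness.\<close>

lemma acyclic_digraph_iff:
  "acyclic_digraph D \<longleftrightarrow> pair_fin_digraph D \<and> acyclic (parcs D)"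
proof -
  have "(\<exists>p. pre_digraph.cycle (with_proj D) p) \<longleftrightarrow> (\<exists>x. (x, x) \<in> (parcs D)\<^sup>+)"
    if "pair_fin_digraph D"
  proof -
    interpret pair_fin_digraph D by (fact that)
    have "(\<exists>p. cycle p) \<longleftrightarrow> (\<exists>p. closed_w p)"
      using closed_w_imp_cycle cycle_altdef by blast
    also have "\<dots> \<longleftrightarrow> (\<exists>x. (x, x) \<in> (parcs D)\<^sup>+)"
      unfolding closed_w_def using reachable1_awalk by auto
    finally show ?thesis .
  qed
  then show ?thesis
    unfolding acyclic_digraph_def acyclic_def by blast
qed

lemma two_le_isolated_of_nonadjacent_neighbours:
  assumes D: "acyclic_digraph D" "competition_graph D = add_isolated G k"
    and nonempty: "pverts G \<noteq> {}"
    and arcs: "parcs G \<subseteq> pverts G \<times> pverts G"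
    and nbs: "\<And>v. v \<in> pverts G \<Longrightarrow>
      \<exists>a b. (v, a) \<in> parcs G \<and> (v, b) \<in> parcs G \<and> a \<noteq> b \<and> (a, b) \<notin> parcs G"
  shows "k \<ge> 2"
proof -
  have fin: "pair_fin_digraph D" and acyc: "acyclic (parcs D)"
    using D(1) by (auto simp: acyclic_digraph_iff)
  have verts: "pverts D = pverts G <+> {..<k}"
    using D(2) by (simp add: competition_graph_def add_isolated_def)
  have comp: "parcs (competition_graph D) = map_prod Inl Inl ` parcs G"
    using D(2) by (simp add: add_isolated_def)
  have "wf ((parcs D)\<inverse>)"
    using acyc fin by (simp add: finite_acyclic_wf_converse pair_fin_digraph.pair_finite_arcs)
  moreover obtain v0 where "v0 \<in> pverts G"
    using nonempty by blast
  \<comment> \<open>Minimality for the converse arc relation gives a vertex of \<open>G\<close> with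
    no prey in \<open>G\<close>.\<close>
  ultimately obtain v' where v': "v' \<in> Inl ` pverts G"
    and last: "\<And>y. (y, v') \<in> (parcs D)\<inverse> \<Longrightarrow> y \<notin> Inl ` pverts G"
    using wfE_min[of "(parcs D)\<inverse>" "Inl v0" "Inl ` pverts G"] by blast
  obtain v where v: "v' = Inl v" "v \<in> pverts G"
    using v' by blast
  obtain a b where ab: "(v, a) \<in> parcs G" "(v, b) \<in> parcs G" "a \<noteq> b" "(a, b) \<notin> parcs G"
    using nbs[OF v(2)] by blast
  have prey: "\<exists>m<k. (Inl v, Inr m) \<in> parcs D \<and> (Inl c, Inr m) \<in> parcs D"
    if "(v, c) \<in> parcs G" for c
  proof -
    have "(Inl v, Inl c) \<in> parcs (competition_graph D)"
      unfolding comp using that by force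
    then obtain x where x: "x \<in> pverts D" "(Inl v, x) \<in> parcs D" "(Inl c, x) \<in> parcs D"
      by (auto simp: competition_graph_def)
    with last[of x] v(1) have "x \<in> Inr ` {..<k}"
      by (auto simp: verts)
    with x show ?thesis by blast
  qed
  obtain m where m: "m < k" "(Inl a, Inr m) \<in> parcs D"
    using prey[OF ab(1)] by blast
  obtain n where n: "n < k" "(Inl b, Inr n) \<in> parcs D"
    using prey[OF ab(2)] by blast
  \<comment> \<open>A prey common to \<open>a\<close> and \<open>b\<close> would make them
    adjacent.\<close>
  have "m \<noteq> n"
  proof
    assume "m = n"
    then have "(Inl a, Inl b) \<in> parcs (competition_graph D)"
      using ab(1-3) arcs m n by (auto simp: competition_graph_def verts)
    then show False
      using ab(4) by (auto simp: comp)
  qed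
  with m(1) n(1) show ?thesis by linarith
qed

lemma pverts_hamming_graph_2:
  "pverts (hamming_graph 2 q) = {[i, j] | i j. i \<in> {1..q} \<and> j \<in> {1..q}}"
  by (auto simp: hamming_graph_def length_Suc_conv numeral_2_eq_2)

lemma parcs_hamming_graph_subset:
  "parcs (hamming_graph n q) \<subseteq> pverts (hamming_graph n q) \<times> pverts (hamming_graph n q)"
  by (auto simp: hamming_graph_def)

lemma parcs_hamming_graph_2_iff:
  "([i, j], [k, l]) \<in> parcs (hamming_graph 2 q) \<longleftrightarrow>
     {i, j, k, l} \<subseteq> {1..q} \<and> (i = k \<longleftrightarrow> j \<noteq> l)"
proof -
  have "{m. m < 2 \<and> [i, j] ! m \<noteq> [k, l] ! m} =
      (if i = k then {} else {0}) \<union> (if j = l then {} else {1::nat})"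
    by (auto simp: less_2_cases_iff)
  then show ?thesis
    by (auto simp: hamming_graph_def)
qed

text \<open>For \<open>i, j \<ge> 2\<close>, row \<open>i\<close> ends at \<open>[i, 1]\<close> and
  column \<open>j\<close> at \<open>[1, j]\<close>, and the prey is the next vertex in the order
  above; after \<open>[2, 1]\<close> this is \<open>[1, q]\<close>. Row 1 and column 1 both end at
  \<open>[1, 1]\<close> and take the two extra vertices.\<close>

fun row_prey :: "nat \<Rightarrow> nat \<Rightarrow> nat list + nat" where
  "row_prey q i = (if i = 1 then Inr 0 else if i = 2 then Inl [1, q] else Inl [i - 1, 1])"

fun column_prey :: "nat \<Rightarrow> nat list + nat" where
  "column_prey j = (if j = 1 then Inr 1 else Inl [1, j - 1])"

definition prey_digraph :: "nat \<Rightarrow> (nat list + nat) pair_pre_digraph" where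
  "prey_digraph q =
     \<lparr> pverts = pverts (hamming_graph 2 q) <+> {..<2},
       parcs = (\<Union>i\<in>{1..q}. \<Union>j\<in>{1..q}.
         {(Inl [i, j], row_prey q i), (Inl [i, j], column_prey j)}) \<rparr>"

text \<open>Position in that order, with ties at 0 for the cells \<open>[i, j]\<close>,
  \<open>i, j \<ge> 2\<close>, and at \<open>2 * q\<close> for the extra vertices. Ties are
  harmless: the former are nobody's prey and the latter have none.\<close>

fun prey_rank :: "nat \<Rightarrow> nat list + nat \<Rightarrow> nat" where
  "prey_rank q (Inl v) =
     (if v ! 0 = 1 then 2 * q - v ! 1 else if v ! 1 = 1 then q + 1 - v ! 0 else 0)"
| "prey_rank q (Inr _) = 2 * q"

lemma prey_in_verts:
  assumes "i \<in> {1..q}"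
  shows "row_prey q i \<in> pverts (prey_digraph q)" "column_prey i \<in> pverts (prey_digraph q)"
  using assms by (auto simp: prey_digraph_def pverts_hamming_graph_2)

lemma row_prey_eq_iff:
  "i \<in> {1..q} \<Longrightarrow> k \<in> {1..q} \<Longrightarrow> row_prey q i = row_prey q k \<longleftrightarrow> i = k"
  by (auto split: if_splits)

lemma column_prey_eq_iff:
  "j \<in> {1..q} \<Longrightarrow> l \<in> {1..q} \<Longrightarrow> column_prey j = column_prey l \<longleftrightarrow> j = l"
  by (auto split: if_splits)

text \<open>The only row prey with first coordinate 1 is \<open>[1, q]\<close>, whereas the column
  prey \<open>[1, j - 1]\<close> stop at \<open>[1, q - 1]\<close>.\<close>

lemma row_prey_neq_column_prey:
  "i \<in> {1..q} \<Longrightarrow> j \<in> {1..q} \<Longrightarrow> row_prey q i \<noteq> column_prey j"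
  by (auto split: if_splits)

lemma acyclic_prey_digraph: "acyclic_digraph (prey_digraph q)"
proof -
  have arcs: "parcs (prey_digraph q) \<subseteq> pverts (prey_digraph q) \<times> pverts (prey_digraph q)"
    using prey_in_verts[of _ q]
    by (auto simp: prey_digraph_def pverts_hamming_graph_2 simp del: row_prey.simps column_prey.simps)
  have fin: "finite (pverts (prey_digraph q))" "finite (parcs (prey_digraph q))"
    by (simp_all add: prey_digraph_def finite_hamming_verts)
  have "pair_fin_digraph (prey_digraph q)"
    using arcs fin by unfold_locales auto
  moreover have "parcs (prey_digraph q) \<subseteq> measure (prey_rank q)"
    by (auto simp: prey_digraph_def split: if_splits)
  then have "acyclic (parcs (prey_digraph q))"
    by (meson acyclic_subset wf_acyclic wf_measure)
  ultimately show ?thesis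
    by (simp add: acyclic_digraph_iff)
qed

lemma competition_graph_prey_digraph:
  "competition_graph (prey_digraph q) = add_isolated (hamming_graph 2 q) 2"
proof -
  have arc_iff: "(u, x) \<in> parcs (prey_digraph q) \<longleftrightarrow>
      (\<exists>i\<in>{1..q}. \<exists>j\<in>{1..q}. u = Inl [i, j] \<and> (x = row_prey q i \<or> x = column_prey j))" for u x
    by (auto simp: prey_digraph_def simp del: row_prey.simps column_prey.simps)
  \<comment> \<open>Distinct lines have distinct prey, so sharing a prey means sharing a line. Equal
    cells are still allowed here.\<close>
  have common: "(\<exists>x\<in>pverts (prey_digraph q). (Inl [i, j], x) \<in> parcs (prey_digraph q) \<and>
      (Inl [k, l], x) \<in> parcs (prey_digraph q)) \<longleftrightarrow> i = k \<or> j = l"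
    if "{i, j, k, l} \<subseteq> {1..q}" for i j k l
    using that prey_in_verts[of _ q] row_prey_eq_iff[of i q k] column_prey_eq_iff[of j q l]
      row_prey_neq_column_prey[of i q l] row_prey_neq_column_prey[of k q j]
    by (auto simp: arc_iff simp del: row_prey.simps column_prey.simps)
  have "(u, v) \<in> parcs (competition_graph (prey_digraph q)) \<longleftrightarrow>
      (u, v) \<in> map_prod Inl Inl ` parcs (hamming_graph 2 q)" (is "?L \<longleftrightarrow> ?R") for u v
  proof -
    \<comment> \<open>Extra vertices have no outgoing arcs, so they are isolated in the competition
      graph.\<close>
    have cells: "\<exists>i j k l. u = Inl [i, j] \<and> v = Inl [k, l] \<and> {i, j, k, l} \<subseteq> {1..q}"
      if "?L \<or> ?R"
      using that parcs_hamming_graph_subset[of 2 q]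
      by (fastforce simp: competition_graph_def arc_iff pverts_hamming_graph_2)
    have "?L \<longleftrightarrow> ?R" if uv: "u = Inl [i, j]" "v = Inl [k, l]" "{i, j, k, l} \<subseteq> {1..q}" for i j k l
    proof -
      have "u \<in> pverts (prey_digraph q)" "v \<in> pverts (prey_digraph q)"
        using uv by (auto simp: prey_digraph_def pverts_hamming_graph_2)
      then have "?L \<longleftrightarrow> u \<noteq> v \<and> (i = k \<or> j = l)"
        using common[OF uv(3)] uv(1,2) by (simp add: competition_graph_def)
      also have "\<dots> \<longleftrightarrow> ([i, j], [k, l]) \<in> parcs (hamming_graph 2 q)"
        using uv by (auto simp: parcs_hamming_graph_2_iff)
      also have "\<dots> \<longleftrightarrow> ?R"
        using uv by force
      finally show ?thesis .
    qed
    with cells show ?thesis by blast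
  qed
  then have "parcs (competition_graph (prey_digraph q)) =
      parcs (add_isolated (hamming_graph 2 q) 2)"
    by (auto simp: add_isolated_def)
  then show ?thesis
    by (simp add: competition_graph_def add_isolated_def prey_digraph_def)
qed

theorem theorem4:
  fixes q :: nat
  assumes "q \<ge> 2"
  shows "competition_number (hamming_graph 2 q) = 2"
  unfolding competition_number_def
proof (rule Least_equality)
  show "\<exists>D. acyclic_digraph D \<and> competition_graph D = add_isolated (hamming_graph 2 q) 2"
    using acyclic_prey_digraph competition_graph_prey_digraph by blast
next
  fix k
  assume "\<exists>D. acyclic_digraph D \<and> competition_graph D = add_isolated (hamming_graph 2 q) k"
  then obtain D where D: "acyclic_digraph D"
      "competition_graph D = add_isolated (hamming_graph 2 q) k"
    by blast
  show "2 \<le> k"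
  proof (rule two_le_isolated_of_nonadjacent_neighbours[OF D])
    have "[1, 1] \<in> pverts (hamming_graph 2 q)"
      using assms by (simp add: pverts_hamming_graph_2)
    then show "pverts (hamming_graph 2 q) \<noteq> {}" by blast
  next
    show "parcs (hamming_graph 2 q) \<subseteq> pverts (hamming_graph 2 q) \<times> pverts (hamming_graph 2 q)"
      by (rule parcs_hamming_graph_subset)
  next
    fix v
    assume "v \<in> pverts (hamming_graph 2 q)"
    then obtain i j where v: "v = [i, j]" "i \<in> {1..q}" "j \<in> {1..q}"
      by (auto simp: pverts_hamming_graph_2)
    have other: "\<exists>m\<in>{1..q}. m \<noteq> n" for n
      by (rule bexI[of _ "if n = 1 then 2 else 1"]) (use assms in auto)
    obtain k l where "k \<in> {1..q}" "k \<noteq> i" "l \<in> {1..q}" "l \<noteq> j"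
      using other by meson
    \<comment> \<open>\<open>[k, j]\<close> and \<open>[i, l]\<close> differ in both coordinates,
      hence are distinct and not adjacent.\<close>
    with v have "(v, [k, j]) \<in> parcs (hamming_graph 2 q) \<and> (v, [i, l]) \<in> parcs (hamming_graph 2 q) \<and>
        [k, j] \<noteq> [i, l] \<and> ([k, j], [i, l]) \<notin> parcs (hamming_graph 2 q)"
      by (auto simp: parcs_hamming_graph_2_iff)
    then show "\<exists>a b. (v, a) \<in> parcs (hamming_graph 2 q) \<and> (v, b) \<in> parcs (hamming_graph 2 q) \<and>
        a \<noteq> b \<and> (a, b) \<notin> parcs (hamming_graph 2 q)"
      by blast
  qed
qed

end
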